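(* Let $A$ be a set, let $\mathscr C\subseteq\mathscr D$ be function clones on $A$, and let $\mathscr G$ be a permutation group on $A$ such that $\mathscr D$ locally interpolates $\mathscr C$ modulo $\mathscr G$. Let $(S,\sim)$ be a subfactor of $\mathscr C$ with $\mathscr G$-invariant $\sim$-classes. (a) If $\sim$ has a $\mathscr D$-invariant very smooth approximation $\eta$ with respect to $\mathscr G$, then there exists a clone homomorphism from $\mathscr D$ to the clone $\mathscr C\curvearrowright S/{\sim}$. (b) If $\sim$ has a $\mathscr D$-invariant smooth approximation $\eta$ with respect to $\mathscr G$, then there exists a minion homomorphism from $\mathscr D$ to $\mathscr C\curvearrowright S/{\sim}$. Moreover, if $\sim$ has finitely many classes, then the homomorphism in (a), resp. (b), can be taken uniformly continuous.
   Context: A function clone on $A$ is a set of finitary operations on $A$ containing all projections and closed under composition. A subfactor of $\mathscr C$ is a pair $(S,\sim)$ where $S\subseteq A$ is invariant under $\mathscr C$ and $\sim$ is a $\mathscr C$-invariant equivalence relation on $S$; $\mathscr C\curvearrowright S/{\sim}$ is the clone on the set of $\sim$-classes induced by the action of $\mathscr C$ on representatives. A function $f$ locally interpolates $g$ (both $k$-ary) modulo $\mathscr G$ if $g$ lies in the closure, in the topology of pointwise convergence, of $\{\beta\circ f(\alpha_1(x_1),\dots,\alpha_k(x_k))\mid\beta,\alpha_1,\dots,\alpha_k\in\mathscr G\}$; $\mathscr D$ locally interpolates $\mathscr C$ modulo $\mathscr G$ if every function of $\mathscr D$ locally interpolates some function of $\mathscr C$. An approximation of $\sim$ is an equivalence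 relation $\eta$ on some $S'$ with $S\subseteq S'\subseteq A$ whose restriction to $S$ refines $\sim$. For $\mathscr G$ leaving $\eta$ and the $\sim$-classes invariant, $\eta$ is very smooth if $\mathscr G$-orbit equivalence on $S$ refines $\eta$; smooth if each $\sim$-class $C$ meets some $\eta$-class $C'$ such that $C\cap C'$ contains a whole $\mathscr G$-orbit. A clone homomorphism preserves arities, projections and composition; a minion homomorphism preserves arities and composition with projections. A (clone or minion) homomorphism $\xi$ from $\mathscr D$ to a clone on a finite set is uniformly continuous if for every $n$ there is a finite $F\subseteq A^n$ such that $\xi(f)=\xi(g)$ whenever $n$-ary $f,g\in\mathscr D$ agree on $F$. *)

theory Defs
  imports "HOL-Analysis.Function_Topology" "HOL-Algebra.Bij" "HOL-Library.NList"
begin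

text \<open>
  Elements of \<open>A\<^sup>n\<close> are lists in \<^term>\<open>nlists n A\<close>, and an \<open>n\<close>-ary operation on \<open>A\<close> is a function
  on lists that is \<^term>\<open>undefined\<close> off \<^term>\<open>nlists n A\<close>.  Since such a function need not determine
  its arity, a set of finitary operations is a family \<open>C\<close> in which \<open>C n\<close> collects the \<open>n\<close>-ary members.
  Arity \<open>0\<close> is permitted but not required: \<open>C 0 = {}\<close> gives the clones without nullary operations.
\<close>

definition ops :: "'a set \<Rightarrow> nat \<Rightarrow> ('a list \<Rightarrow> 'a) set" where
  "ops A n = nlists n A \<rightarrow>\<^sub>E A"

definition op_proj :: "'a set \<Rightarrow> nat \<Rightarrow> nat \<Rightarrow> 'a list \<Rightarrow> 'a" where
  "op_proj A n i = (\<lambda>xs\<in>nlists n A. xs ! i)"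

definition op_comp :: "'a set \<Rightarrow> nat \<Rightarrow> ('a list \<Rightarrow> 'a) \<Rightarrow> ('a list \<Rightarrow> 'a) list \<Rightarrow> 'a list \<Rightarrow> 'a" where
  "op_comp A n f gs = (\<lambda>xs\<in>nlists n A. f (map (\<lambda>g. g xs) gs))"

definition function_clone :: "'a set \<Rightarrow> (nat \<Rightarrow> ('a list \<Rightarrow> 'a) set) \<Rightarrow> bool" where
  "function_clone A C \<longleftrightarrow>
     (\<forall>n. C n \<subseteq> ops A n) \<and>
     (\<forall>n. \<forall>i<n. op_proj A n i \<in> C n) \<and>
     (\<forall>m n. \<forall>f\<in>C m. \<forall>gs\<in>nlists m (C n). op_comp A n f gs \<in> C n)"

definition invariant_set :: "(nat \<Rightarrow> ('a list \<Rightarrow> 'a) set) \<Rightarrow> 'a set \<Rightarrow> bool" where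
  "invariant_set C S \<longleftrightarrow> (\<forall>n. \<forall>f\<in>C n. \<forall>xs\<in>nlists n S. f xs \<in> S)"

definition invariant_rel :: "(nat \<Rightarrow> ('a list \<Rightarrow> 'a) set) \<Rightarrow> ('a \<times> 'a) set \<Rightarrow> bool" where
  "invariant_rel C R \<longleftrightarrow>
     (\<forall>n. \<forall>f\<in>C n. \<forall>ps\<in>nlists n R. (f (map fst ps), f (map snd ps)) \<in> R)"

definition subfactor ::
    "'a set \<Rightarrow> (nat \<Rightarrow> ('a list \<Rightarrow> 'a) set) \<Rightarrow> 'a set \<Rightarrow> ('a \<times> 'a) set \<Rightarrow> bool" where
  "subfactor A C S E \<longleftrightarrow> S \<subseteq> A \<and> invariant_set C S \<and> equiv S E \<and> invariant_rel C E"

definition quotient_clone ::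
    "(nat \<Rightarrow> ('a list \<Rightarrow> 'a) set) \<Rightarrow> 'a set \<Rightarrow> ('a \<times> 'a) set \<Rightarrow> nat \<Rightarrow> ('a set list \<Rightarrow> 'a set) set" where
  "quotient_clone C S E n =
     {h \<in> ops (S // E) n. \<exists>f\<in>C n. \<forall>xs\<in>nlists n S. h (map (\<lambda>x. E `` {x}) xs) = E `` {f xs}}"

definition locally_interpolates_op ::
    "'a set \<Rightarrow> ('a \<Rightarrow> 'a) set \<Rightarrow> nat \<Rightarrow> ('a list \<Rightarrow> 'a) \<Rightarrow> ('a list \<Rightarrow> 'a) \<Rightarrow> bool" where
  "locally_interpolates_op A G n f g \<longleftrightarrow>
     g \<in> product_topology (\<lambda>_. discrete_topology A) (nlists n A) closure_of
       {(\<lambda>xs\<in>nlists n A. b (f (map2 (\<lambda>a x. a x) as xs))) | b as. b \<in> G \<and> as \<in> nlists n G}"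

definition locally_interpolates ::
    "'a set \<Rightarrow> ('a \<Rightarrow> 'a) set \<Rightarrow> (nat \<Rightarrow> ('a list \<Rightarrow> 'a) set) \<Rightarrow> (nat \<Rightarrow> ('a list \<Rightarrow> 'a) set) \<Rightarrow> bool" where
  "locally_interpolates A G D C \<longleftrightarrow>
     (\<forall>n. \<forall>f\<in>D n. \<exists>g\<in>C n. locally_interpolates_op A G n f g)"

definition perm_orbit :: "('a \<Rightarrow> 'a) set \<Rightarrow> 'a \<Rightarrow> 'a set" where
  "perm_orbit G x = {g x | g. g \<in> G}"

definition perm_invariant_classes :: "('a \<Rightarrow> 'a) set \<Rightarrow> 'a set \<Rightarrow> ('a \<times> 'a) set \<Rightarrow> bool" where
  "perm_invariant_classes G S E \<longleftrightarrow> (\<forall>K\<in>S // E. \<forall>g\<in>G. g ` K \<subseteq> K)"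

definition perm_invariant_rel :: "('a \<Rightarrow> 'a) set \<Rightarrow> ('a \<times> 'a) set \<Rightarrow> bool" where
  "perm_invariant_rel G R \<longleftrightarrow> (\<forall>g\<in>G. \<forall>(x, y)\<in>R. (g x, g y) \<in> R)"

definition approximation ::
    "'a set \<Rightarrow> 'a set \<Rightarrow> ('a \<times> 'a) set \<Rightarrow> 'a set \<Rightarrow> ('a \<times> 'a) set \<Rightarrow> bool" where
  "approximation A S E S' \<eta> \<longleftrightarrow> S \<subseteq> S' \<and> S' \<subseteq> A \<and> equiv S' \<eta> \<and> \<eta> \<inter> S \<times> S \<subseteq> E"

definition very_smooth_approximation ::
    "'a set \<Rightarrow> ('a \<Rightarrow> 'a) set \<Rightarrow> 'a set \<Rightarrow> ('a \<times> 'a) set \<Rightarrow> 'a set \<Rightarrow> ('a \<times> 'a) set \<Rightarrow> bool" where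
  "very_smooth_approximation A G S E S' \<eta> \<longleftrightarrow>
     approximation A S E S' \<eta> \<and> perm_invariant_rel G \<eta> \<and> perm_invariant_classes G S E \<and>
     (\<forall>x\<in>S. \<forall>y\<in>S. y \<in> perm_orbit G x \<longrightarrow> (x, y) \<in> \<eta>)"

text \<open>Below, \<open>x \<in> A\<close> is needed because permutations of \<open>A\<close> take junk values off \<open>A\<close>.\<close>

definition smooth_approximation ::
    "'a set \<Rightarrow> ('a \<Rightarrow> 'a) set \<Rightarrow> 'a set \<Rightarrow> ('a \<times> 'a) set \<Rightarrow> 'a set \<Rightarrow> ('a \<times> 'a) set \<Rightarrow> bool" where
  "smooth_approximation A G S E S' \<eta> \<longleftrightarrow>
     approximation A S E S' \<eta> \<and> perm_invariant_rel G \<eta> \<and> perm_invariant_classes G S E \<and>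
     (\<forall>K\<in>S // E. \<exists>K'\<in>S' // \<eta>. K \<inter> K' \<noteq> {} \<and> (\<exists>x\<in>A. perm_orbit G x \<subseteq> K \<inter> K'))"

definition clone_homomorphism ::
    "'a set \<Rightarrow> (nat \<Rightarrow> ('a list \<Rightarrow> 'a) set) \<Rightarrow> 'b set \<Rightarrow> (nat \<Rightarrow> ('b list \<Rightarrow> 'b) set) \<Rightarrow>
     (nat \<Rightarrow> ('a list \<Rightarrow> 'a) \<Rightarrow> 'b list \<Rightarrow> 'b) \<Rightarrow> bool" where
  "clone_homomorphism A C B D \<xi> \<longleftrightarrow>
     (\<forall>n. \<forall>f\<in>C n. \<xi> n f \<in> D n) \<and>
     (\<forall>n. \<forall>i<n. \<xi> n (op_proj A n i) = op_proj B n i) \<and>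
     (\<forall>m n. \<forall>f\<in>C m. \<forall>gs\<in>nlists m (C n).
        \<xi> n (op_comp A n f gs) = op_comp B n (\<xi> m f) (map (\<xi> n) gs))"

definition minion_homomorphism ::
    "'a set \<Rightarrow> (nat \<Rightarrow> ('a list \<Rightarrow> 'a) set) \<Rightarrow> 'b set \<Rightarrow> (nat \<Rightarrow> ('b list \<Rightarrow> 'b) set) \<Rightarrow>
     (nat \<Rightarrow> ('a list \<Rightarrow> 'a) \<Rightarrow> 'b list \<Rightarrow> 'b) \<Rightarrow> bool" where
  "minion_homomorphism A C B D \<xi> \<longleftrightarrow>
     (\<forall>n. \<forall>f\<in>C n. \<xi> n f \<in> D n) \<and>
     (\<forall>m n. \<forall>f\<in>C m. \<forall>js\<in>nlists m {..<n}.
        \<xi> n (op_comp A n f (map (op_proj A n) js)) =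
        op_comp B n (\<xi> m f) (map (op_proj B n) js))"

definition uniformly_continuous_hom ::
    "'a set \<Rightarrow> (nat \<Rightarrow> ('a list \<Rightarrow> 'a) set) \<Rightarrow> (nat \<Rightarrow> ('a list \<Rightarrow> 'a) \<Rightarrow> 'b list \<Rightarrow> 'b) \<Rightarrow> bool" where
  "uniformly_continuous_hom A D \<xi> \<longleftrightarrow>
     (\<forall>n. \<exists>F. finite F \<and> F \<subseteq> nlists n A \<and>
        (\<forall>f\<in>D n. \<forall>g\<in>D n. (\<forall>xs\<in>F. f xs = g xs) \<longrightarrow> \<xi> n f = \<xi> n g))"

end

theory Submission
  imports Defs
begin

text \<open>
  Let \<open>f \<in> \<D>\<close> locally interpolate \<open>f' \<in> \<C>\<close>, and let \<open>xs\<close> be a tuple in \<open>S\<close> each of whose entries is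
  \<open>\<eta>\<close>-equivalent to its whole \<open>G\<close>-orbit.  Evaluating the interpolation at \<open>xs\<close> gives
  \<open>f' xs = \<beta> (f (\<alpha>\<^sub>1 x\<^sub>1, \<dots>, \<alpha>\<^sub>n x\<^sub>n))\<close>.  The value \<open>f (\<alpha>\<^sub>1 x\<^sub>1, \<dots>, \<alpha>\<^sub>n x\<^sub>n)\<close> is \<open>\<eta>\<close>-equivalent to \<open>f xs\<close>, and it
  lies in the \<open>\<sim>\<close>-class of \<open>f' xs\<close> because the classes are \<open>G\<close>-invariant.  As \<open>\<eta>\<close> refines \<open>\<sim>\<close> on \<open>S\<close>,
  the class of \<open>f' xs\<close> is the only one meeting the \<open>\<eta>\<close>-class of \<open>f xs\<close>; it therefore depends on \<open>f\<close>
  alone.  Smoothness provides one such tuple of representatives for every tuple of classes, which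
  yields a minion homomorphism; if the approximation is very smooth, all tuples in \<open>S\<close> qualify, and
  the map respects composition.  With finitely many classes, only the finitely many tuples of
  representatives matter.
\<close>

\<comment> \<open>These rules make the simplifier loop as soon as it may unfold \<^const>\<open>nlists\<close>.\<close>
declare nlistsE_length [simp del] nlistsE_set [simp del]

section \<open>Tuples, pointwise closure, and permutation groups\<close>

lemma nlists_map2_in:
  assumes "as \<in> nlists n G" "xs \<in> nlists n S" "\<And>a x. a \<in> G \<Longrightarrow> x \<in> S \<Longrightarrow> a x \<in> T"
  shows "map2 (\<lambda>a x. a x) as xs \<in> nlists n T"
proof -
  have "a x \<in> T" if "(a, x) \<in> set (zip as xs)" for a x
    using assms set_zip_leftD[OF that] set_zip_rightD[OF that] by (auto simp: nlists_def)
  then show ?thesis using assms(1,2) by (auto simp: nlists_def)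
qed

lemma nlists_map_in:
  assumes "xs \<in> nlists n S" "\<And>x. x \<in> S \<Longrightarrow> h x \<in> T"
  shows "map h xs \<in> nlists n T"
  using assms by (auto simp: nlists_def)

lemma finite_nlists:
  assumes "finite T"
  shows "finite (nlists n T)"
  using finite_lists_length_eq[OF assms, of n]
  by (simp add: nlists_def conj_commute)

lemma invariant_relD:
  assumes "invariant_rel C R" "f \<in> C n" "length xs = n" "list_all2 (\<lambda>x y. (x, y) \<in> R) xs ys"
  shows "(f xs, f ys) \<in> R"
proof -
  have "length ys = length xs" using assms(4) by (simp add: list_all2_lengthD)
  moreover have "zip xs ys \<in> nlists n R"
    using assms(3,4) by (auto simp: nlists_def list_all2_iff)
  ultimately show ?thesis
    using assms(1,2) unfolding invariant_rel_def by (metis map_fst_zip map_snd_zip)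
qed

text \<open>As the factors are discrete, the functions agreeing with \<open>g\<close> at the one
  tuple \<open>xs\<close> form an open neighbourhood of \<open>g\<close>, so some interpolating
  function lies in it.\<close>

lemma locally_interpolates_op_at:
  assumes "locally_interpolates_op A G n f g" "xs \<in> nlists n A"
  obtains b as where "b \<in> G" "as \<in> nlists n G" "g xs = b (f (map2 (\<lambda>a x. a x) as xs))"
proof -
  let ?X = "product_topology (\<lambda>_. discrete_topology A) (nlists n A)"
  let ?T = "{h \<in> topspace ?X. h xs \<in> {g xs}}"
  have g: "g \<in> topspace ?X"
    and dense: "\<And>T. g \<in> T \<Longrightarrow> openin ?X T \<Longrightarrow>
      \<exists>y\<in>{(\<lambda>xs\<in>nlists n A. b (f (map2 (\<lambda>a x. a x) as xs))) | b as. b \<in> G \<and> as \<in> nlists n G}. y \<in> T"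
    using assms(1) unfolding locally_interpolates_op_def in_closure_of by blast+
  have "g xs \<in> A" using g assms(2) by (auto simp: PiE_iff)
  then have "openin ?X ?T"
    by (intro openin_continuous_map_preimage[OF continuous_map_product_projection[OF assms(2)]]) auto
  from dense[OF _ this] g show ?thesis
    using assms(2) that by auto
qed

lemma subgroup_BijGroup_left_inverse:
  assumes "subgroup G (BijGroup A)" "b \<in> G"
  obtains c where "c \<in> G" "\<And>y. y \<in> A \<Longrightarrow> c (b y) = y"
proof -
  have b: "b \<in> Bij A"
    using subgroup.subset[OF assms(1)] assms(2) by (auto simp: BijGroup_def)
  have "(\<lambda>x\<in>A. (inv_into A b) x) \<in> G"
    using subgroup.m_inv_closed[OF assms] inv_BijGroup[OF b] by simp
  moreover have "(\<lambda>x\<in>A. (inv_into A b) x) (b y) = y" if "y \<in> A" for y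
    using b that by (auto simp: Bij_def bij_betw_def)
  ultimately show ?thesis using that by blast
qed

lemma subgroup_BijGroup_id:
  assumes "subgroup G (BijGroup A)"
  obtains e where "e \<in> G" "\<And>y. y \<in> A \<Longrightarrow> e y = y"
  using subgroup.one_closed[OF assms] by (force simp: BijGroup_def)

lemma perm_invariant_classesD:
  assumes "perm_invariant_classes G S E" "equiv S E" "g \<in> G" "x \<in> S"
  shows "(x, g x) \<in> E"
proof -
  have "x \<in> E `` {x}" using assms(2,4) by (rule equiv_class_self)
  moreover have "E `` {x} \<in> S // E" using assms(4) by (rule quotientI)
  ultimately show ?thesis using assms(1,3) unfolding perm_invariant_classes_def by blast
qed

section \<open>The setting shared by smooth and very smooth approximations; the orbit condition that
  distinguishes them is added lemma by lemma\<close>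

locale approximated_subfactor =
  fixes A S S' :: "'a set" and \<C> \<D> :: "nat \<Rightarrow> ('a list \<Rightarrow> 'a) set"
    and G :: "('a \<Rightarrow> 'a) set" and E \<eta> :: "('a \<times> 'a) set"
  assumes clone_D: "function_clone A \<D>"
    and group: "subgroup G (BijGroup A)"
    and interpolates: "locally_interpolates A G \<D> \<C>"
    and subfactor: "subfactor A \<C> S E"
    and classes: "perm_invariant_classes G S E"
    and approx: "approximation A S E S' \<eta>"
    and invariant: "invariant_rel \<D> \<eta>"
begin

lemma S_sub: "S \<subseteq> A" and equiv_E: "equiv S E" and inv_S: "invariant_set \<C> S"
  and inv_E: "invariant_rel \<C> E"
  using subfactor by (auto simp: subfactor_def)

lemma S_sub_S': "S \<subseteq> S'" and equiv_eta: "equiv S' \<eta>" and eta_refines: "\<eta> \<inter> S \<times> S \<subseteq> E"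
  using approx by (auto simp: approximation_def)

lemma eta_trans: "(x, y) \<in> \<eta> \<Longrightarrow> (y, z) \<in> \<eta> \<Longrightarrow> (x, z) \<in> \<eta>"
  using equiv_eta by (meson equivE transD)

lemma eta_sym: "(x, y) \<in> \<eta> \<Longrightarrow> (y, x) \<in> \<eta>"
  using equiv_eta by (meson equivE symD)

lemma perm_in_class: "g \<in> G \<Longrightarrow> x \<in> S \<Longrightarrow> (x, g x) \<in> E"
  by (rule perm_invariant_classesD[OF classes equiv_E])

lemma perm_in_S: "g \<in> G \<Longrightarrow> x \<in> S \<Longrightarrow> g x \<in> S"
  using perm_in_class equiv_E by (meson equiv_class_eq_iff)

lemma interpolant_class:
  assumes f: "f \<in> \<D> n" and f': "f' \<in> \<C> n" and int: "locally_interpolates_op A G n f f'"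
    and xs: "xs \<in> nlists n S" and orbit: "\<And>x g. x \<in> set xs \<Longrightarrow> g \<in> G \<Longrightarrow> (x, g x) \<in> \<eta>"
  obtains s where "s \<in> S" "(f xs, s) \<in> \<eta>" "(f' xs, s) \<in> E"
proof -
  have "xs \<in> nlists n A" using xs S_sub by (auto simp: nlists_def)
  with int obtain b as where b: "b \<in> G" and as: "as \<in> nlists n G"
    and eq: "f' xs = b (f (map2 (\<lambda>a x. a x) as xs))"
    by (rule locally_interpolates_op_at)
  let ?ys = "map2 (\<lambda>a x. a x) as xs"
  \<comment> \<open>Undoing \<open>b\<close> inside \<open>G\<close> recovers \<open>f ?ys\<close>
    as \<open>c (f' xs)\<close>. This is the witness \<open>s\<close>: the class of
    \<open>f' xs\<close> is \<open>G\<close>-invariant and so contains it. The cancellation holds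
    only on \<open>A\<close>, whence the check that \<open>f ?ys\<close> lies in
    \<open>A\<close>.\<close>
  obtain c where c: "c \<in> G" "\<And>y. y \<in> A \<Longrightarrow> c (b y) = y"
    using subgroup_BijGroup_left_inverse[OF group b] by blast
  have ys: "?ys \<in> nlists n S" using as xs perm_in_S by (rule nlists_map2_in)
  then have "?ys \<in> nlists n A" using S_sub by (auto simp: nlists_def)
  then have "f ?ys \<in> A"
    using f clone_D unfolding function_clone_def ops_def by blast
  with c(2) eq have s: "c (f' xs) = f ?ys" by simp
  have f'S: "f' xs \<in> S" using inv_S f' xs by (auto simp: invariant_set_def)
  have "list_all2 (\<lambda>x y. (x, y) \<in> \<eta>) xs ?ys"
    using as xs by (auto simp: nlists_def list_all2_conv_all_nth intro!: orbit)
  then have "(f xs, f ?ys) \<in> \<eta>"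
    using invariant_relD[OF invariant f] xs by (simp add: nlists_def)
  then show ?thesis
    using that perm_in_S[OF c(1) f'S] perm_in_class[OF c(1) f'S] unfolding s by blast
qed

text \<open>Any two elements of \<open>S\<close> in one \<open>\<eta>\<close>-class are
  \<open>E\<close>-equivalent, so any one of them determines the result. The point \<open>y\<close>
  itself may lie outside \<open>S\<close>.\<close>

lemma class_of_eta:
  assumes "s \<in> S" "(y, s) \<in> \<eta>"
  shows "E `` (\<eta> `` {y} \<inter> S) = E `` {s}"
proof -
  have "(s, t) \<in> E" if "t \<in> \<eta> `` {y} \<inter> S" for t
    using that assms eta_refines eta_trans eta_sym by blast
  then show ?thesis
    using assms equiv_class_eq[OF equiv_E] by blast
qed

section \<open>The induced map from operations to operations on classes\<close>

text \<open>Members of \<open>\<D>\<close> need not preserve \<open>S\<close>, so the value of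
  \<open>f\<close> at the representatives may leave \<open>S\<close>; its
  \<open>\<eta>\<close>-class is cut back to \<open>S\<close> and then saturated under
  \<open>E\<close>. No interpolant enters, so none has to be chosen.\<close>

definition class_map :: "('a set \<Rightarrow> 'a) \<Rightarrow> nat \<Rightarrow> ('a list \<Rightarrow> 'a) \<Rightarrow> 'a set list \<Rightarrow> 'a set" where
  "class_map rep n f = (\<lambda>Ks\<in>nlists n (S // E). E `` (\<eta> `` {f (map rep Ks)} \<inter> S))"

text \<open>Representatives of this kind are all that is used of smoothness for the minion
  homomorphism.\<close>

definition smooth_reps :: "('a set \<Rightarrow> 'a) \<Rightarrow> bool" where
  "smooth_reps rep \<longleftrightarrow>
     (\<forall>K\<in>S // E. rep K \<in> K \<and> (\<forall>g\<in>G. (rep K, g (rep K)) \<in> \<eta>))"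

lemma reps_in_S:
  assumes "smooth_reps rep" "Ks \<in> nlists n (S // E)"
  shows "map rep Ks \<in> nlists n S"
  by (rule nlists_map_in[OF assms(2)])
    (use assms(1) in_quotient_imp_subset[OF equiv_E] in \<open>auto simp: smooth_reps_def\<close>)

text \<open>The entries of \<open>xs\<close> are \<open>E\<close>-equivalent to the representatives
  of their classes, so invariance of \<open>E\<close> under \<open>\<C>\<close> moves
  \<open>f'\<close> to the representatives, where the orbit condition is available. In particular
  all interpolants of \<open>f\<close> in \<open>\<C> n\<close> act alike on the classes.\<close>

lemma class_map_interpolant:
  assumes reps: "smooth_reps rep" and f: "f \<in> \<D> n" and f': "f' \<in> \<C> n"
    and int: "locally_interpolates_op A G n f f'" and xs: "xs \<in> nlists n S"
  shows "class_map rep n f (map (\<lambda>x. E `` {x}) xs) = E `` {f' xs}"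
proof -
  let ?Ks = "map (\<lambda>x. E `` {x}) xs"
  have Ks: "?Ks \<in> nlists n (S // E)"
    using xs by (rule nlists_map_in) (rule quotientI)
  have "(x, g x) \<in> \<eta>" if "x \<in> set (map rep ?Ks)" "g \<in> G" for x g
    using reps Ks that unfolding smooth_reps_def nlists_def by auto
  then obtain s where s: "s \<in> S" "(f (map rep ?Ks), s) \<in> \<eta>" "(f' (map rep ?Ks), s) \<in> E"
    using interpolant_class[OF f f' int reps_in_S[OF reps Ks]] by blast
  have "(x, rep (E `` {x})) \<in> E" if "x \<in> S" for x
    using reps quotientI[OF that, of E] by (auto simp: smooth_reps_def)
  then have "list_all2 (\<lambda>x y. (x, y) \<in> E) xs (map rep ?Ks)"
    using xs by (auto simp: nlists_def list_all2_conv_all_nth subset_iff)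
  then have "(f' xs, f' (map rep ?Ks)) \<in> E"
    using invariant_relD[OF inv_E f'] xs by (simp add: nlists_def)
  then have "E `` {f' xs} = E `` {s}"
    using s(3) equiv_class_eq[OF equiv_E] by metis
  then show ?thesis
    using Ks class_of_eta[OF s(1,2)] by (simp add: class_map_def)
qed

lemma map_class_surj:
  assumes "Ks \<in> nlists n (S // E)"
  obtains xs where "xs \<in> nlists n S" "Ks = map (\<lambda>x. E `` {x}) xs"
proof -
  have "Ks \<in> lists ((\<lambda>x. E `` {x}) ` S)"
    using assms by (auto simp: nlists_def quotient_def)
  then obtain xs where "xs \<in> lists S" "Ks = map (\<lambda>x. E `` {x}) xs"
    by (auto simp: lists_image)
  then show ?thesis using that assms by (auto simp: nlists_def)
qed

lemma class_map_in_quotient_clone: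
  assumes reps: "smooth_reps rep" and f: "f \<in> \<D> n"
  shows "class_map rep n f \<in> quotient_clone \<C> S E n"
proof -
  obtain f' where f': "f' \<in> \<C> n" "locally_interpolates_op A G n f f'"
    using interpolates f unfolding locally_interpolates_def by blast
  note eq = class_map_interpolant[OF reps f f']
  have "class_map rep n f Ks \<in> S // E" if Ks: "Ks \<in> nlists n (S // E)" for Ks
  proof -
    obtain xs where xs: "xs \<in> nlists n S" "Ks = map (\<lambda>x. E `` {x}) xs"
      using map_class_surj[OF Ks] .
    have "f' xs \<in> S" using inv_S f'(1) xs(1) by (auto simp: invariant_set_def)
    then show ?thesis using eq[OF xs(1)] xs(2) by (simp add: quotientI)
  qed
  moreover have "class_map rep n f \<in> extensional (nlists n (S // E))"
    by (simp add: class_map_def)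
  ultimately show ?thesis
    using eq f'(1) unfolding quotient_clone_def ops_def by (auto simp: PiE_iff)
qed

section \<open>Homomorphism properties and uniform continuity\<close>

text \<open>Choosing representatives commutes with selecting coordinates, so both sides evaluate
  \<open>f\<close> at the same tuple. Values of general inner operations need not be
  representatives, so this argument covers projections only.\<close>

lemma minion_homomorphism_class_map:
  assumes reps: "smooth_reps rep"
  shows "minion_homomorphism A \<D> (S // E) (quotient_clone \<C> S E) (class_map rep)"
  unfolding minion_homomorphism_def
proof (intro conjI allI ballI)
  fix m n :: nat and f js
  assume f: "f \<in> \<D> m" and js: "js \<in> nlists m {..<n}"
  show "class_map rep n (op_comp A n f (map (op_proj A n) js)) =
      op_comp (S // E) n (class_map rep m f) (map (op_proj (S // E) n) js)"
  proof
    fix Ks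
    show "class_map rep n (op_comp A n f (map (op_proj A n) js)) Ks =
        op_comp (S // E) n (class_map rep m f) (map (op_proj (S // E) n) js) Ks"
    proof (cases "Ks \<in> nlists n (S // E)")
      case True
      have "map rep Ks \<in> nlists n A"
        using reps_in_S[OF reps True] S_sub by (auto simp: nlists_def)
      moreover have "map (\<lambda>j. map rep Ks ! j) js = map rep (map (\<lambda>j. Ks ! j) js)"
        using js True by (auto simp: nlists_def)
      moreover have "map (\<lambda>j. Ks ! j) js \<in> nlists m (S // E)"
        using js True by (auto simp: nlists_def subset_iff)
      ultimately show ?thesis
        using True by (simp add: class_map_def op_comp_def op_proj_def comp_def cong: map_cong)
    \<comment> \<open>Off the tuples of classes both sides are \<open>undefined\<close>.\<close>
    qed (simp_all add: class_map_def op_comp_def)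
  qed
qed (rule class_map_in_quotient_clone[OF reps])

lemma clone_homomorphism_class_map:
  assumes reps: "smooth_reps rep" and orbit: "\<And>x g. x \<in> S \<Longrightarrow> g \<in> G \<Longrightarrow> (x, g x) \<in> \<eta>"
  shows "clone_homomorphism A \<D> (S // E) (quotient_clone \<C> S E) (class_map rep)"
proof -
  \<comment> \<open>With every orbit inside one \<open>\<eta>\<close>-class, the value can be read
    off at any tuple \<open>xs\<close> of \<open>S\<close>, not just at the chosen
    representatives.\<close>
  have val: "\<exists>s\<in>S. (f xs, s) \<in> \<eta> \<and> class_map rep n f (map (\<lambda>x. E `` {x}) xs) = E `` {s}"
    if f: "f \<in> \<D> n" and xs: "xs \<in> nlists n S" for f n xs
  proof -
    obtain f' where f': "f' \<in> \<C> n" "locally_interpolates_op A G n f f'"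
      using interpolates f unfolding locally_interpolates_def by blast
    have "(x, g x) \<in> \<eta>" if "x \<in> set xs" "g \<in> G" for x g
      using orbit that xs by (auto simp: nlists_def)
    then obtain s where s: "s \<in> S" "(f xs, s) \<in> \<eta>" "(f' xs, s) \<in> E"
      using interpolant_class[OF f f' xs] by blast
    then show ?thesis
      using class_map_interpolant[OF reps f f' xs] equiv_class_eq[OF equiv_E s(3)] by auto
  qed
  have unique: "class_map rep n f (map (\<lambda>x. E `` {x}) xs) = E `` {t}"
    if f: "f \<in> \<D> n" and xs: "xs \<in> nlists n S" and t: "t \<in> S" "(f xs, t) \<in> \<eta>" for f n xs t
    using val[OF f xs] class_of_eta[OF t] class_of_eta by auto
  show ?thesis
    unfolding clone_homomorphism_def
  proof (intro conjI allI ballI impI)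
    fix n i :: nat
    assume i: "i < n"
    have proj: "op_proj A n i \<in> \<D> n"
      using clone_D i by (auto simp: function_clone_def)
    show "class_map rep n (op_proj A n i) = op_proj (S // E) n i"
    proof
      fix Ks
      show "class_map rep n (op_proj A n i) Ks = op_proj (S // E) n i Ks"
      proof (cases "Ks \<in> nlists n (S // E)")
        case True
        then obtain xs where xs: "xs \<in> nlists n S" "Ks = map (\<lambda>x. E `` {x}) xs"
          by (rule map_class_surj)
        have "xs ! i \<in> S" "xs \<in> nlists n A"
          using xs(1) i S_sub by (auto simp: nlists_def)
        \<comment> \<open>A projection stays in \<open>S\<close>, so its own value serves as
          \<open>t\<close> in \<open>unique\<close>, by reflexivity of
          \<open>\<eta>\<close>.\<close>
        then have "(op_proj A n i xs, xs ! i) \<in> \<eta>"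
          using S_sub_S' equiv_eta by (auto simp: op_proj_def equiv_class_eq_iff)
        with proj xs(1) \<open>xs ! i \<in> S\<close>
        have "class_map rep n (op_proj A n i) Ks = E `` {xs ! i}"
          unfolding xs(2) by (intro unique)
        also have "\<dots> = Ks ! i"
          using xs i by (auto simp: nlists_def)
        finally show ?thesis using True by (simp add: op_proj_def)
      qed (simp_all add: class_map_def op_proj_def)
    qed
  next
    fix m n :: nat and f gs
    assume f: "f \<in> \<D> m" and gs: "gs \<in> nlists m (\<D> n)"
    have fgs: "op_comp A n f gs \<in> \<D> n"
      using clone_D f gs by (auto simp: function_clone_def)
    show "class_map rep n (op_comp A n f gs) =
        op_comp (S // E) n (class_map rep m f) (map (class_map rep n) gs)"
    proof
      fix Ks
      show "class_map rep n (op_comp A n f gs) Ks =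
          op_comp (S // E) n (class_map rep m f) (map (class_map rep n) gs) Ks"
      proof (cases "Ks \<in> nlists n (S // E)")
        case True
        then obtain xs where xs: "xs \<in> nlists n S" "Ks = map (\<lambda>x. E `` {x}) xs"
          by (rule map_class_surj)
        have "\<forall>g\<in>\<D> n. \<exists>s. s \<in> S \<and> (g xs, s) \<in> \<eta> \<and> class_map rep n g Ks = E `` {s}"
          using val[OF _ xs(1)] xs(2) by blast
        \<comment> \<open>Inner values \<open>g xs\<close> may leave \<open>S\<close>. Replacing
          each by an \<open>\<eta>\<close>-equivalent \<open>s g\<close> in \<open>S\<close> gives a
          tuple to which \<open>val\<close> applies for the outer \<open>f\<close>; invariance of
          \<open>\<eta>\<close> under \<open>f\<close> then compares the two outer values.\<close>
        then obtain s where s: "\<And>g. g \<in> \<D> n \<Longrightarrow>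
            s g \<in> S \<and> (g xs, s g) \<in> \<eta> \<and> class_map rep n g Ks = E `` {s g}"
          by metis
        have ss: "map s gs \<in> nlists m S"
          using gs by (rule nlists_map_in) (use s in blast)
        obtain t where t: "t \<in> S" "(f (map s gs), t) \<in> \<eta>"
          "class_map rep m f (map (\<lambda>x. E `` {x}) (map s gs)) = E `` {t}"
          using val[OF f ss] by blast
        have "list_all2 (\<lambda>x y. (x, y) \<in> \<eta>) (map (\<lambda>g. g xs) gs) (map s gs)"
          using gs s by (auto simp: nlists_def list_all2_conv_all_nth subset_iff)
        then have "(f (map (\<lambda>g. g xs) gs), f (map s gs)) \<in> \<eta>"
          using invariant_relD[OF invariant f] gs by (simp add: nlists_def)
        moreover have "xs \<in> nlists n A" using xs(1) S_sub by (auto simp: nlists_def)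
        ultimately have "(op_comp A n f gs xs, t) \<in> \<eta>"
          using t(2) eta_trans by (simp add: op_comp_def)
        then have "class_map rep n (op_comp A n f gs) Ks = E `` {t}"
          using unique[OF fgs xs(1) t(1)] xs(2) by simp
        moreover have "map (\<lambda>g. class_map rep n g Ks) gs = map (\<lambda>x. E `` {x}) (map s gs)"
          using gs s by (auto simp: nlists_def)
        ultimately show ?thesis
          using True t(3) by (simp add: op_comp_def comp_def cong: map_cong)
      qed (simp_all add: class_map_def op_comp_def)
    qed
  qed (rule class_map_in_quotient_clone[OF reps])
qed

text \<open>In arity \<open>n\<close>, the map sees \<open>f\<close> only at tuples of
  representatives, and finitely many classes give finitely many of these.\<close>

lemma uniformly_continuous_class_map:
  assumes reps: "smooth_reps rep" and fin: "finite (S // E)"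
  shows "uniformly_continuous_hom A \<D> (class_map rep)"
  unfolding uniformly_continuous_hom_def
proof (intro allI exI conjI ballI impI)
  fix n
  let ?F = "map rep ` nlists n (S // E)"
  show "finite ?F" using finite_nlists[OF fin] by blast
  show "?F \<subseteq> nlists n A" using reps_in_S[OF reps] S_sub by (fastforce simp: nlists_def)
  fix f g :: "'a list \<Rightarrow> 'a"
  assume "\<forall>xs\<in>?F. f xs = g xs"
  then show "class_map rep n f = class_map rep n g"
    unfolding class_map_def by (auto intro!: restrict_ext)
qed

lemma smooth_repsI:
  assumes "\<And>K. K \<in> S // E \<Longrightarrow> \<exists>x\<in>K. \<forall>g\<in>G. (x, g x) \<in> \<eta>"
  obtains rep where "smooth_reps rep"
  using assms unfolding smooth_reps_def by metis

end

theorem theorem3p9: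
  fixes A S :: "'a set"
    and \<C> \<D> :: "nat \<Rightarrow> ('a list \<Rightarrow> 'a) set"
    and G :: "('a \<Rightarrow> 'a) set"
    and E :: "('a \<times> 'a) set"
  assumes "function_clone A \<C>"
    and "function_clone A \<D>"
    and "\<forall>n. \<C> n \<subseteq> \<D> n"
    and "subgroup G (BijGroup A)"
    and "locally_interpolates A G \<D> \<C>"
    and "subfactor A \<C> S E"
    and "perm_invariant_classes G S E"
  shows "((\<exists>S' \<eta>. very_smooth_approximation A G S E S' \<eta> \<and> invariant_rel \<D> \<eta>) \<longrightarrow>
           (\<exists>\<xi>. clone_homomorphism A \<D> (S // E) (quotient_clone \<C> S E) \<xi>) \<and>
           (finite (S // E) \<longrightarrow>
             (\<exists>\<xi>. clone_homomorphism A \<D> (S // E) (quotient_clone \<C> S E) \<xi> \<and>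
                  uniformly_continuous_hom A \<D> \<xi>))) \<and>
         ((\<exists>S' \<eta>. smooth_approximation A G S E S' \<eta> \<and> invariant_rel \<D> \<eta>) \<longrightarrow>
           (\<exists>\<xi>. minion_homomorphism A \<D> (S // E) (quotient_clone \<C> S E) \<xi>) \<and>
           (finite (S // E) \<longrightarrow>
             (\<exists>\<xi>. minion_homomorphism A \<D> (S // E) (quotient_clone \<C> S E) \<xi> \<and>
                  uniformly_continuous_hom A \<D> \<xi>)))"
proof -
  have approximated: "approximated_subfactor A S S' \<C> \<D> G E \<eta>"
    if "approximation A S E S' \<eta>" "invariant_rel \<D> \<eta>" for S' \<eta>
    using assms that by (intro approximated_subfactor.intro)
  \<comment> \<open>A single \<open>\<xi>\<close> serves both with and without finiteness of the
    quotient.\<close>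
  have "\<exists>\<xi>. clone_homomorphism A \<D> (S // E) (quotient_clone \<C> S E) \<xi> \<and>
      (finite (S // E) \<longrightarrow> uniformly_continuous_hom A \<D> \<xi>)"
    if smooth: "very_smooth_approximation A G S E S' \<eta>" and inv: "invariant_rel \<D> \<eta>" for S' \<eta>
  proof -
    interpret approximated_subfactor A S S' \<C> \<D> G E \<eta>
      using approximated smooth inv by (simp add: very_smooth_approximation_def)
    have orbit: "(x, g x) \<in> \<eta>" if "x \<in> S" "g \<in> G" for x g
      using smooth that perm_in_S[OF that(2,1)]
      unfolding very_smooth_approximation_def perm_orbit_def by blast
    \<comment> \<open>Under very smoothness any element of the nonempty class \<open>K\<close> is a
      suitable representative.\<close>
    have "\<exists>x\<in>K. \<forall>g\<in>G. (x, g x) \<in> \<eta>" if "K \<in> S // E" for K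
      using in_quotient_imp_non_empty[OF equiv_E that] in_quotient_imp_subset[OF equiv_E that] orbit
      by blast
    then obtain rep where "smooth_reps rep" by (rule smooth_repsI)
    then show ?thesis
      using clone_homomorphism_class_map orbit uniformly_continuous_class_map by blast
  qed
  moreover have "\<exists>\<xi>. minion_homomorphism A \<D> (S // E) (quotient_clone \<C> S E) \<xi> \<and>
      (finite (S // E) \<longrightarrow> uniformly_continuous_hom A \<D> \<xi>)"
    if smooth: "smooth_approximation A G S E S' \<eta>" and inv: "invariant_rel \<D> \<eta>" for S' \<eta>
  proof -
    interpret approximated_subfactor A S S' \<C> \<D> G E \<eta>
      using approximated smooth inv by (simp add: smooth_approximation_def)
    have "\<exists>x\<in>K. \<forall>g\<in>G. (x, g x) \<in> \<eta>" if K: "K \<in> S // E" for K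
    proof -
      obtain K' x where K': "K' \<in> S' // \<eta>" and x: "x \<in> A" "perm_orbit G x \<subseteq> K \<inter> K'"
        using smooth K unfolding smooth_approximation_def by blast
      \<comment> \<open>The identity puts \<open>x\<close> itself into its orbit, so
        \<open>x\<close> lies in \<open>K\<close> and shares the \<open>\<eta>\<close>-class
        \<open>K'\<close> with all its images.\<close>
      obtain e where e: "e \<in> G" "e x = x" using subgroup_BijGroup_id[OF group] x(1) by metis
      have "g x \<in> K \<inter> K'" if "g \<in> G" for g
        using x(2) that unfolding perm_orbit_def by blast
      with e show ?thesis
        using in_quotient_imp_in_rel[OF equiv_eta K'] by (metis Int_iff empty_subsetI insert_subset)
    qed
    then obtain rep where "smooth_reps rep" by (rule smooth_repsI)
    then show ?thesis
      using minion_homomorphism_class_map uniformly_continuous_class_map by blast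
  qed
  ultimately show ?thesis by meson
qed

end
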